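(* Let $A$ be a noetherian integral domain containing $\mathbb{R}$ such that $\mathbb{R}$ is algebraically closed in $A$, and suppose that $B=\mathbb{C}\otimes_{\mathbb{R}}A=A[i]$ is an integral domain. If $A$ is a UFD, then the polar group $\Pi(A)$ is torsion free.
   Context: Let $K=\mathrm{frac}(A)$ and $L=\mathrm{frac}(B)=K[i]$, and let $R^*$ denote the unit group of a ring $R$. The polar group of $A$ is the abelian group $\Pi(A)=L^*/B^*K^*$. *)

theory Defs
  imports "HOL-Algebra.Algebra" "HOL-Algebra.Algebraic_Closure_Type"
begin

definition fraction_rel :: "('a, 'm) ring_scheme \<Rightarrow> (('a \<times> 'a) \<times> ('a \<times> 'a)) set" where
  "fraction_rel R = {((a, b), (c, d)). a \<in> carrier R \<and> b \<in> carrier R - {\<zero>\<^bsub>R\<^esub>} \<and>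
     c \<in> carrier R \<and> d \<in> carrier R - {\<zero>\<^bsub>R\<^esub>} \<and> a \<otimes>\<^bsub>R\<^esub> d = c \<otimes>\<^bsub>R\<^esub> b}"

definition fraction :: "('a, 'm) ring_scheme \<Rightarrow> 'a \<Rightarrow> 'a \<Rightarrow> ('a \<times> 'a) set" where
  "fraction R a b = fraction_rel R `` {(a, b)}"

definition Frac :: "('a, 'm) ring_scheme \<Rightarrow> ('a \<times> 'a) set ring" where
  "Frac R = \<lparr>
     carrier = (carrier R \<times> (carrier R - {\<zero>\<^bsub>R\<^esub>})) // fraction_rel R,
     monoid.mult = (\<lambda>U V. \<Union>(a, b)\<in>U. \<Union>(c, d)\<in>V. fraction R (a \<otimes>\<^bsub>R\<^esub> c) (b \<otimes>\<^bsub>R\<^esub> d)),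
     one = fraction R \<one>\<^bsub>R\<^esub> \<one>\<^bsub>R\<^esub>,
     ring.zero = fraction R \<zero>\<^bsub>R\<^esub> \<one>\<^bsub>R\<^esub>,
     add = (\<lambda>U V. \<Union>(a, b)\<in>U. \<Union>(c, d)\<in>V.
       fraction R (a \<otimes>\<^bsub>R\<^esub> d \<oplus>\<^bsub>R\<^esub> c \<otimes>\<^bsub>R\<^esub> b) (b \<otimes>\<^bsub>R\<^esub> d))\<rparr>"

definition to_Frac :: "('a, 'm) ring_scheme \<Rightarrow> 'a \<Rightarrow> ('a \<times> 'a) set" where
  "to_Frac R a = fraction R a \<one>\<^bsub>R\<^esub>"

text \<open>The map \<open>a/b \<mapsto> f a / f b\<close> into \<open>Frac S\<close> induced by an injective homomorphism \<open>f\<close> into \<open>S\<close>.\<close>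

definition Frac_map :: "('b, 'n) ring_scheme \<Rightarrow> ('a \<Rightarrow> 'b) \<Rightarrow> ('a \<times> 'a) set \<Rightarrow> ('b \<times> 'b) set" where
  "Frac_map S f U = (\<Union>(a, b)\<in>U. fraction S (f a) (f b))"

context domain
begin

lemma fraction_rel_equiv:
  "equiv (carrier R \<times> (carrier R - {\<zero>})) (fraction_rel R)"
proof (rule equivI)
  show "fraction_rel R \<subseteq> (carrier R \<times> (carrier R - {\<zero>})) \<times> (carrier R \<times> (carrier R - {\<zero>}))"
    by (auto simp: fraction_rel_def)
  show "refl_on (carrier R \<times> (carrier R - {\<zero>})) (fraction_rel R)"
    by (auto simp: refl_on_def fraction_rel_def)
  show "sym (fraction_rel R)"
    by (auto simp: sym_def fraction_rel_def)
  show "trans (fraction_rel R)"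
  proof (rule transI)
    fix x y z assume "(x, y) \<in> fraction_rel R" "(y, z) \<in> fraction_rel R"
    then obtain a b c d e f where
      xyz: "x = (a, b)" "y = (c, d)" "z = (e, f)" and
      C: "a \<in> carrier R" "b \<in> carrier R" "c \<in> carrier R" "d \<in> carrier R"
         "e \<in> carrier R" "f \<in> carrier R" and
      N: "b \<noteq> \<zero>" "d \<noteq> \<zero>" "f \<noteq> \<zero>" and
      E: "a \<otimes> d = c \<otimes> b" "c \<otimes> f = e \<otimes> d"
      by (auto simp: fraction_rel_def)
    have "d \<otimes> (a \<otimes> f) = (a \<otimes> d) \<otimes> f" using C by algebra
    also have "\<dots> = (c \<otimes> f) \<otimes> b" unfolding E(1) using C by algebra
    also have "\<dots> = d \<otimes> (e \<otimes> b)" unfolding E(2) using C by algebra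
    finally have "a \<otimes> f = e \<otimes> b" using C N by (simp add: m_lcancel)
    then show "(x, z) \<in> fraction_rel R" using C N by (simp add: xyz fraction_rel_def)
  qed
qed

lemma fraction_eq_iff:
  assumes "a \<in> carrier R" "b \<in> carrier R" "b \<noteq> \<zero>" "c \<in> carrier R" "d \<in> carrier R" "d \<noteq> \<zero>"
  shows "fraction R a b = fraction R c d \<longleftrightarrow> a \<otimes> d = c \<otimes> b"
  unfolding fraction_def
  by (subst eq_equiv_class_iff[OF fraction_rel_equiv]) (use assms in \<open>auto simp: fraction_rel_def\<close>)

lemma fraction_in_carrier [simp]:
  assumes "a \<in> carrier R" "b \<in> carrier R" "b \<noteq> \<zero>"
  shows "fraction R a b \<in> carrier (Frac R)"
  using assms unfolding fraction_def Frac_def by (auto intro: quotientI)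

lemma Frac_cases:
  assumes "U \<in> carrier (Frac R)"
  obtains a b where "a \<in> carrier R" "b \<in> carrier R" "b \<noteq> \<zero>" "U = fraction R a b"
  using assms unfolding fraction_def Frac_def by (auto elim!: quotientE)

lemma mem_fraction_iff:
  assumes "a \<in> carrier R" "b \<in> carrier R" "b \<noteq> \<zero>"
  shows "(c, d) \<in> fraction R a b \<longleftrightarrow>
    c \<in> carrier R \<and> d \<in> carrier R \<and> d \<noteq> \<zero> \<and> fraction R c d = fraction R a b"
proof -
  have "(c, d) \<in> fraction R a b \<longleftrightarrow>
    c \<in> carrier R \<and> d \<in> carrier R \<and> d \<noteq> \<zero> \<and> a \<otimes> d = c \<otimes> b"
    using assms by (auto simp: fraction_def fraction_rel_def)
  then show ?thesis using assms fraction_eq_iff by metis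
qed

lemma fraction_self_mem:
  assumes "a \<in> carrier R" "b \<in> carrier R" "b \<noteq> \<zero>"
  shows "(a, b) \<in> fraction R a b"
  using assms by (simp add: mem_fraction_iff)

lemma UN_fraction:
  assumes "a \<in> carrier R" "b \<in> carrier R" "b \<noteq> \<zero>"
    and "\<And>c d. \<lbrakk>c \<in> carrier R; d \<in> carrier R; d \<noteq> \<zero>; a \<otimes> d = c \<otimes> b\<rbrakk> \<Longrightarrow> g c d = g a b"
  shows "(\<Union>(c, d)\<in>fraction R a b. g c d) = g a b"
proof -
  have "g c d = g a b" if "(c, d) \<in> fraction R a b" for c d
    using that assms by (metis mem_fraction_iff fraction_eq_iff)
  then show ?thesis using fraction_self_mem[OF assms(1-3)] by fast
qed

lemma Frac_mult:
  assumes C: "a \<in> carrier R" "b \<in> carrier R" "b \<noteq> \<zero>" "c \<in> carrier R" "d \<in> carrier R" "d \<noteq> \<zero>"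
  shows "fraction R a b \<otimes>\<^bsub>Frac R\<^esub> fraction R c d = fraction R (a \<otimes> c) (b \<otimes> d)"
proof -
  have inner: "(\<Union>(c, d)\<in>fraction R c d. fraction R (a \<otimes> c) (b \<otimes> d)) = fraction R (a \<otimes> c) (b \<otimes> d)"
    if "a \<in> carrier R" "b \<in> carrier R" "b \<noteq> \<zero>" for a b
  proof (rule UN_fraction)
    fix e f assume ef: "e \<in> carrier R" "f \<in> carrier R" "f \<noteq> \<zero>" "c \<otimes> f = e \<otimes> d"
    have "(a \<otimes> e) \<otimes> (b \<otimes> d) = (a \<otimes> b) \<otimes> (e \<otimes> d)" using C ef(1-3) that by algebra
    also have "\<dots> = (a \<otimes> b) \<otimes> (c \<otimes> f)" by (simp add: ef(4))
    also have "\<dots> = (a \<otimes> c) \<otimes> (b \<otimes> f)" using C ef(1-3) that by algebra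
    finally show "fraction R (a \<otimes> e) (b \<otimes> f) = fraction R (a \<otimes> c) (b \<otimes> d)"
      using C ef that by (subst fraction_eq_iff) (auto simp: integral_iff)
  qed (use C in auto)
  have "fraction R a b \<otimes>\<^bsub>Frac R\<^esub> fraction R c d =
      (\<Union>(a, b)\<in>fraction R a b. \<Union>(c, d)\<in>fraction R c d. fraction R (a \<otimes> c) (b \<otimes> d))"
    by (simp add: Frac_def)
  also have "\<dots> = (\<Union>(c, d)\<in>fraction R c d. fraction R (a \<otimes> c) (b \<otimes> d))"
  proof (rule UN_fraction)
    fix e f assume ef: "e \<in> carrier R" "f \<in> carrier R" "f \<noteq> \<zero>" "a \<otimes> f = e \<otimes> b"
    have "(e \<otimes> c) \<otimes> (b \<otimes> d) = (c \<otimes> d) \<otimes> (e \<otimes> b)" using C ef(1-3) by algebra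
    also have "\<dots> = (c \<otimes> d) \<otimes> (a \<otimes> f)" by (simp add: ef(4))
    also have "\<dots> = (a \<otimes> c) \<otimes> (f \<otimes> d)" using C ef(1-3) by algebra
    finally have "fraction R (e \<otimes> c) (f \<otimes> d) = fraction R (a \<otimes> c) (b \<otimes> d)"
      using C ef by (subst fraction_eq_iff) (auto simp: integral_iff)
    then show "(\<Union>(c, d)\<in>fraction R c d. fraction R (e \<otimes> c) (f \<otimes> d)) =
        (\<Union>(c, d)\<in>fraction R c d. fraction R (a \<otimes> c) (b \<otimes> d))"
      using inner ef C by simp
  qed (use C in auto)
  also have "\<dots> = fraction R (a \<otimes> c) (b \<otimes> d)" using inner C by simp
  finally show ?thesis .
qed

lemma Frac_add:
  assumes C: "a \<in> carrier R" "b \<in> carrier R" "b \<noteq> \<zero>" "c \<in> carrier R" "d \<in> carrier R" "d \<noteq> \<zero>"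
  shows "fraction R a b \<oplus>\<^bsub>Frac R\<^esub> fraction R c d = fraction R (a \<otimes> d \<oplus> c \<otimes> b) (b \<otimes> d)"
proof -
  have inner: "(\<Union>(c, d)\<in>fraction R c d. fraction R (a \<otimes> d \<oplus> c \<otimes> b) (b \<otimes> d)) =
      fraction R (a \<otimes> d \<oplus> c \<otimes> b) (b \<otimes> d)"
    if "a \<in> carrier R" "b \<in> carrier R" "b \<noteq> \<zero>" for a b
  proof (rule UN_fraction)
    fix e f assume ef: "e \<in> carrier R" "f \<in> carrier R" "f \<noteq> \<zero>" "c \<otimes> f = e \<otimes> d"
    have "(a \<otimes> f \<oplus> e \<otimes> b) \<otimes> (b \<otimes> d) = (a \<otimes> b \<otimes> d \<otimes> f) \<oplus> (b \<otimes> b) \<otimes> (e \<otimes> d)"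
      using C ef(1-3) that by algebra
    also have "\<dots> = (a \<otimes> b \<otimes> d \<otimes> f) \<oplus> (b \<otimes> b) \<otimes> (c \<otimes> f)" by (simp add: ef(4))
    also have "\<dots> = (a \<otimes> d \<oplus> c \<otimes> b) \<otimes> (b \<otimes> f)" using C ef(1-3) that by algebra
    finally show "fraction R (a \<otimes> f \<oplus> e \<otimes> b) (b \<otimes> f) = fraction R (a \<otimes> d \<oplus> c \<otimes> b) (b \<otimes> d)"
      using C ef that by (subst fraction_eq_iff) (auto simp: integral_iff)
  qed (use C in auto)
  have "fraction R a b \<oplus>\<^bsub>Frac R\<^esub> fraction R c d =
      (\<Union>(a, b)\<in>fraction R a b. \<Union>(c, d)\<in>fraction R c d. fraction R (a \<otimes> d \<oplus> c \<otimes> b) (b \<otimes> d))"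
    by (simp add: Frac_def)
  also have "\<dots> = (\<Union>(c, d)\<in>fraction R c d. fraction R (a \<otimes> d \<oplus> c \<otimes> b) (b \<otimes> d))"
  proof (rule UN_fraction)
    fix e f assume ef: "e \<in> carrier R" "f \<in> carrier R" "f \<noteq> \<zero>" "a \<otimes> f = e \<otimes> b"
    have "(e \<otimes> d \<oplus> c \<otimes> f) \<otimes> (b \<otimes> d) = (d \<otimes> d) \<otimes> (e \<otimes> b) \<oplus> (b \<otimes> c \<otimes> d \<otimes> f)"
      using C ef(1-3) by algebra
    also have "\<dots> = (d \<otimes> d) \<otimes> (a \<otimes> f) \<oplus> (b \<otimes> c \<otimes> d \<otimes> f)" by (simp add: ef(4))
    also have "\<dots> = (a \<otimes> d \<oplus> c \<otimes> b) \<otimes> (f \<otimes> d)" using C ef(1-3) by algebra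
    finally have "fraction R (e \<otimes> d \<oplus> c \<otimes> f) (f \<otimes> d) = fraction R (a \<otimes> d \<oplus> c \<otimes> b) (b \<otimes> d)"
      using C ef by (subst fraction_eq_iff) (auto simp: integral_iff)
    then show "(\<Union>(c, d)\<in>fraction R c d. fraction R (e \<otimes> d \<oplus> c \<otimes> f) (f \<otimes> d)) =
        (\<Union>(c, d)\<in>fraction R c d. fraction R (a \<otimes> d \<oplus> c \<otimes> b) (b \<otimes> d))"
      using inner ef C by simp
  qed (use C in auto)
  also have "\<dots> = fraction R (a \<otimes> d \<oplus> c \<otimes> b) (b \<otimes> d)" using inner C by simp
  finally show ?thesis .
qed

lemma Frac_one: "\<one>\<^bsub>Frac R\<^esub> = fraction R \<one> \<one>"
  and Frac_zero: "\<zero>\<^bsub>Frac R\<^esub> = fraction R \<zero> \<one>"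
  by (simp_all add: Frac_def)

lemma Frac_is_cring: "cring (Frac R)"
proof (rule cringI)
  show "abelian_group (Frac R)"
  proof (rule abelian_groupI)
    fix U V W assume "U \<in> carrier (Frac R)" "V \<in> carrier (Frac R)" "W \<in> carrier (Frac R)"
    then obtain a b c d e f where
      "U = fraction R a b" "V = fraction R c d" "W = fraction R e f" and
      C: "a \<in> carrier R" "b \<in> carrier R" "c \<in> carrier R" "d \<in> carrier R"
         "e \<in> carrier R" "f \<in> carrier R" "b \<noteq> \<zero>" "d \<noteq> \<zero>" "f \<noteq> \<zero>"
      by (elim Frac_cases) (rule that; assumption)
    moreover have "((a \<otimes> d \<oplus> c \<otimes> b) \<otimes> f \<oplus> e \<otimes> (b \<otimes> d)) \<otimes> (b \<otimes> (d \<otimes> f)) =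
        (a \<otimes> (d \<otimes> f) \<oplus> (c \<otimes> f \<oplus> e \<otimes> d) \<otimes> b) \<otimes> (b \<otimes> d \<otimes> f)"
      using C by algebra
    ultimately show "U \<oplus>\<^bsub>Frac R\<^esub> V \<oplus>\<^bsub>Frac R\<^esub> W = U \<oplus>\<^bsub>Frac R\<^esub> (V \<oplus>\<^bsub>Frac R\<^esub> W)"
      by (simp add: Frac_add fraction_eq_iff integral_iff)
  next
    fix U V assume "U \<in> carrier (Frac R)" "V \<in> carrier (Frac R)"
    then obtain a b c d where
      UV: "U = fraction R a b" "V = fraction R c d" and
      C: "a \<in> carrier R" "b \<in> carrier R" "c \<in> carrier R" "d \<in> carrier R" "b \<noteq> \<zero>" "d \<noteq> \<zero>"
      by (elim Frac_cases) (rule that; assumption)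
    show "U \<oplus>\<^bsub>Frac R\<^esub> V \<in> carrier (Frac R)"
      using C by (simp add: UV Frac_add integral_iff)
    have "(a \<otimes> d \<oplus> c \<otimes> b) \<otimes> (d \<otimes> b) = (c \<otimes> b \<oplus> a \<otimes> d) \<otimes> (b \<otimes> d)" using C by algebra
    then show "U \<oplus>\<^bsub>Frac R\<^esub> V = V \<oplus>\<^bsub>Frac R\<^esub> U"
      using C by (simp add: UV Frac_add fraction_eq_iff integral_iff)
  next
    fix U assume "U \<in> carrier (Frac R)"
    then obtain a b where U: "U = fraction R a b" and
      C: "a \<in> carrier R" "b \<in> carrier R" "b \<noteq> \<zero>" by (elim Frac_cases) (rule that; assumption)
    show "\<zero>\<^bsub>Frac R\<^esub> \<oplus>\<^bsub>Frac R\<^esub> U = U" using C by (simp add: U Frac_zero Frac_add)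
    have "\<ominus> a \<otimes> b \<oplus> a \<otimes> b = \<zero>" using C by algebra
    then have "fraction R (\<ominus> a) b \<oplus>\<^bsub>Frac R\<^esub> U = \<zero>\<^bsub>Frac R\<^esub>"
      using C by (simp add: U Frac_zero Frac_add fraction_eq_iff integral_iff)
    then show "\<exists>V\<in>carrier (Frac R). V \<oplus>\<^bsub>Frac R\<^esub> U = \<zero>\<^bsub>Frac R\<^esub>" using C by force
  qed (simp add: Frac_zero)
  show "comm_monoid (Frac R)"
  proof (rule comm_monoidI)
    fix U V W assume "U \<in> carrier (Frac R)" "V \<in> carrier (Frac R)" "W \<in> carrier (Frac R)"
    then show "U \<otimes>\<^bsub>Frac R\<^esub> V \<otimes>\<^bsub>Frac R\<^esub> W = U \<otimes>\<^bsub>Frac R\<^esub> (V \<otimes>\<^bsub>Frac R\<^esub> W)"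
      by (elim Frac_cases) (simp add: Frac_mult integral_iff m_assoc)
  next
    fix U V assume "U \<in> carrier (Frac R)" "V \<in> carrier (Frac R)"
    then show "U \<otimes>\<^bsub>Frac R\<^esub> V \<in> carrier (Frac R)" "U \<otimes>\<^bsub>Frac R\<^esub> V = V \<otimes>\<^bsub>Frac R\<^esub> U"
      by (auto elim!: Frac_cases simp: Frac_mult integral_iff m_comm)
  next
    fix U assume "U \<in> carrier (Frac R)"
    then show "\<one>\<^bsub>Frac R\<^esub> \<otimes>\<^bsub>Frac R\<^esub> U = U"
      by (auto elim!: Frac_cases simp: Frac_one Frac_mult)
  qed (simp add: Frac_one)
  fix U V W assume "U \<in> carrier (Frac R)" "V \<in> carrier (Frac R)" "W \<in> carrier (Frac R)"
  then obtain a b c d e f where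
    "U = fraction R a b" "V = fraction R c d" "W = fraction R e f" and
    C: "a \<in> carrier R" "b \<in> carrier R" "c \<in> carrier R" "d \<in> carrier R"
       "e \<in> carrier R" "f \<in> carrier R" "b \<noteq> \<zero>" "d \<noteq> \<zero>" "f \<noteq> \<zero>"
    by (elim Frac_cases) (rule that; assumption)
  moreover have "(a \<otimes> d \<oplus> c \<otimes> b) \<otimes> e \<otimes> (b \<otimes> f \<otimes> (d \<otimes> f)) =
      (a \<otimes> e \<otimes> (d \<otimes> f) \<oplus> c \<otimes> e \<otimes> (b \<otimes> f)) \<otimes> (b \<otimes> d \<otimes> f)"
    using C by algebra
  ultimately show "(U \<oplus>\<^bsub>Frac R\<^esub> V) \<otimes>\<^bsub>Frac R\<^esub> W = U \<otimes>\<^bsub>Frac R\<^esub> W \<oplus>\<^bsub>Frac R\<^esub> V \<otimes>\<^bsub>Frac R\<^esub> W"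
    by (simp add: Frac_add Frac_mult fraction_eq_iff integral_iff)
qed

lemma Frac_is_field: "field (Frac R)"
proof (rule cring.cring_fieldI2[OF Frac_is_cring])
  show "\<zero>\<^bsub>Frac R\<^esub> \<noteq> \<one>\<^bsub>Frac R\<^esub>" by (simp add: Frac_zero Frac_one fraction_eq_iff)
  fix U assume U: "U \<in> carrier (Frac R)" "U \<noteq> \<zero>\<^bsub>Frac R\<^esub>"
  then obtain a b where ab: "a \<in> carrier R" "b \<in> carrier R" "b \<noteq> \<zero>" "U = fraction R a b"
    by (elim Frac_cases) (rule that; assumption)
  then have "a \<noteq> \<zero>" using U by (auto simp: Frac_zero fraction_eq_iff)
  then have "U \<otimes>\<^bsub>Frac R\<^esub> fraction R b a = \<one>\<^bsub>Frac R\<^esub>"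
    using ab by (simp add: Frac_one Frac_mult fraction_eq_iff integral_iff m_comm)
  then show "\<exists>V\<in>carrier (Frac R). U \<otimes>\<^bsub>Frac R\<^esub> V = \<one>\<^bsub>Frac R\<^esub>"
    using ab \<open>a \<noteq> \<zero>\<close> by force
qed

lemma to_Frac_hom: "to_Frac R \<in> ring_hom R (Frac R)"
  by (rule ring_hom_memI) (simp_all add: to_Frac_def Frac_mult Frac_add Frac_one)

lemma to_Frac_inj: "inj_on (to_Frac R) (carrier R)"
  by (auto simp: inj_on_def to_Frac_def fraction_eq_iff)

lemma Frac_map_fraction:
  assumes S: "domain S" and f: "f \<in> ring_hom R S" "inj_on f (carrier R)"
    and "a \<in> carrier R" "b \<in> carrier R" "b \<noteq> \<zero>"
  shows "Frac_map S f (fraction R a b) = fraction S (f a) (f b)"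
    and "f b \<noteq> \<zero>\<^bsub>S\<^esub>"
proof -
  interpret S: domain S by (fact S)
  have f0: "f \<zero> = \<zero>\<^bsub>S\<^esub>"
    using ring_hom_zero[OF f(1) ring_axioms S.ring_axioms] .
  have nz: "f x \<noteq> \<zero>\<^bsub>S\<^esub>" if "x \<in> carrier R" "x \<noteq> \<zero>" for x
    using inj_onD[OF f(2) _ that(1) zero_closed] f0 that by auto
  then show "f b \<noteq> \<zero>\<^bsub>S\<^esub>" using assms by simp
  show "Frac_map S f (fraction R a b) = fraction S (f a) (f b)"
    unfolding Frac_map_def
  proof (rule UN_fraction)
    fix c d assume cd: "c \<in> carrier R" "d \<in> carrier R" "d \<noteq> \<zero>" "a \<otimes> d = c \<otimes> b"
    then have "f a \<otimes>\<^bsub>S\<^esub> f d = f c \<otimes>\<^bsub>S\<^esub> f b"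
      using assms by (metis ring_hom_mult[OF f(1)])
    then show "fraction S (f c) (f d) = fraction S (f a) (f b)"
      using cd assms nz by (subst S.fraction_eq_iff) (auto simp: ring_hom_closed[OF f(1)])
  qed (use assms in auto)
qed

lemma Frac_map_hom:
  assumes S: "domain S" and f: "f \<in> ring_hom R S" "inj_on f (carrier R)"
  shows "Frac_map S f \<in> ring_hom (Frac R) (Frac S)"
proof -
  interpret S: domain S by (fact S)
  note fr = Frac_map_fraction[OF S f]
  note hom = ring_hom_closed[OF f(1)] ring_hom_mult[OF f(1)] ring_hom_add[OF f(1)]
    ring_hom_one[OF f(1)]
  show ?thesis
  proof (rule ring_hom_memI)
    fix U V assume "U \<in> carrier (Frac R)" "V \<in> carrier (Frac R)"
    then show "Frac_map S f U \<in> carrier (Frac S)"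
      and "Frac_map S f (U \<otimes>\<^bsub>Frac R\<^esub> V) = Frac_map S f U \<otimes>\<^bsub>Frac S\<^esub> Frac_map S f V"
      and "Frac_map S f (U \<oplus>\<^bsub>Frac R\<^esub> V) = Frac_map S f U \<oplus>\<^bsub>Frac S\<^esub> Frac_map S f V"
      by (auto elim!: Frac_cases simp: fr hom Frac_mult Frac_add S.Frac_mult S.Frac_add integral_iff)
  next
    show "Frac_map S f \<one>\<^bsub>Frac R\<^esub> = \<one>\<^bsub>Frac S\<^esub>" by (simp add: Frac_one S.Frac_one fr hom)
  qed
qed

end

text \<open>
  For a real algebra \<open>A\<close>, the algebra \<open>\<complex> \<otimes> A = A[i]\<close> is free over \<open>A\<close> with basis \<open>1, i\<close>; the pair
  \<open>(a, b)\<close> is \<open>a + ib\<close>. The defining universal property of the tensor product is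
  \<open>complexification_universal\<close> below.
\<close>

definition complexification :: "('a, 'm) ring_scheme \<Rightarrow> ('a \<times> 'a) ring" where
  "complexification A = \<lparr>
     carrier = carrier A \<times> carrier A,
     monoid.mult = (\<lambda>(a, b) (c, d).
       (a \<otimes>\<^bsub>A\<^esub> c \<ominus>\<^bsub>A\<^esub> b \<otimes>\<^bsub>A\<^esub> d, a \<otimes>\<^bsub>A\<^esub> d \<oplus>\<^bsub>A\<^esub> b \<otimes>\<^bsub>A\<^esub> c)),
     one = (\<one>\<^bsub>A\<^esub>, \<zero>\<^bsub>A\<^esub>),
     ring.zero = (\<zero>\<^bsub>A\<^esub>, \<zero>\<^bsub>A\<^esub>),
     add = (\<lambda>(a, b) (c, d). (a \<oplus>\<^bsub>A\<^esub> c, b \<oplus>\<^bsub>A\<^esub> d))\<rparr>"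

definition to_complexification :: "('a, 'm) ring_scheme \<Rightarrow> 'a \<Rightarrow> 'a \<times> 'a" where
  "to_complexification A a = (a, \<zero>\<^bsub>A\<^esub>)"

abbreviation real_ring :: "real ring" where "real_ring \<equiv> ring_of_type_algebra"

abbreviation complex_ring :: "complex ring" where "complex_ring \<equiv> ring_of_type_algebra"

context cring
begin

lemma complexification_is_cring: "cring (complexification R)"
proof (rule cringI)
  show "abelian_group (complexification R)"
  proof (rule abelian_groupI)
    fix x assume x: "x \<in> carrier (complexification R)"
    show "\<exists>y\<in>carrier (complexification R). y \<oplus>\<^bsub>complexification R\<^esub> x = \<zero>\<^bsub>complexification R\<^esub>"
      by (rule bexI[of _ "(\<ominus> fst x, \<ominus> snd x)"]) (use x in \<open>auto simp: complexification_def l_neg\<close>)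
  qed (auto simp: complexification_def a_ac)
  show "comm_monoid (complexification R)"
    by (rule comm_monoidI)
      (auto simp: complexification_def minus_eq l_distr r_distr l_minus r_minus minus_add m_ac a_ac)
qed (auto simp: complexification_def minus_eq l_distr r_distr l_minus r_minus minus_add m_ac a_ac)

lemma to_complexification_hom: "to_complexification R \<in> ring_hom R (complexification R)"
  by (rule ring_hom_memI) (auto simp: to_complexification_def complexification_def minus_eq)

lemma to_complexification_inj: "inj_on (to_complexification R) (carrier R)"
  by (auto simp: inj_on_def to_complexification_def)

text \<open>With the structure map \<open>z \<mapsto> (\<iota> (Re z), \<iota> (Im z))\<close> from \<open>\<complex>\<close>, the complexification is the pushout
  of \<open>\<complex> \<leftarrow> \<real> \<rightarrow> A\<close> in commutative rings.\<close>

lemma complex_to_complexification_hom: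
  assumes \<iota>: "\<iota> \<in> ring_hom real_ring R"
  shows "(\<lambda>z. (\<iota> (Re z), \<iota> (Im z))) \<in> ring_hom complex_ring (complexification R)"
    and "(\<iota> (Re (of_real r)), \<iota> (Im (of_real r))) = to_complexification R (\<iota> r)"
proof -
  have rr: "ring real_ring" by (rule ring_from_type_algebra)
  have c: "\<iota> x \<in> carrier R" for x
    using ring_hom_closed[OF \<iota>, of x] by (simp add: ring_of_type_algebra_def)
  have add: "\<iota> (x + y) = \<iota> x \<oplus> \<iota> y" for x y
    using ring_hom_add[OF \<iota>, of x y] by (simp add: ring_of_type_algebra_def)
  have mult: "\<iota> (x * y) = \<iota> x \<otimes> \<iota> y" for x y
    using ring_hom_mult[OF \<iota>, of x y] by (simp add: ring_of_type_algebra_def)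
  have one: "\<iota> 1 = \<one>"
    using ring_hom_one[OF \<iota>] by (simp add: ring_of_type_algebra_def)
  have zero: "\<iota> 0 = \<zero>"
    using ring_hom_zero[OF \<iota> rr ring_axioms] by (simp add: ring_of_type_algebra_def)
  have diff: "\<iota> (x - y) = \<iota> x \<ominus> \<iota> y" for x y
  proof -
    have "\<iota> (x - y) \<oplus> \<iota> y = \<iota> x" using add[of "x - y" y] by simp
    moreover have "\<iota> (x - y) = (\<iota> (x - y) \<oplus> \<iota> y) \<ominus> \<iota> y"
      using c[of "x - y"] c[of y] by algebra
    ultimately show ?thesis by simp
  qed
  show "(\<lambda>z. (\<iota> (Re z), \<iota> (Im z))) \<in> ring_hom complex_ring (complexification R)"
    by (rule ring_hom_memI)
      (auto simp: ring_of_type_algebra_def complexification_def c add mult one zero diff)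
  show "(\<iota> (Re (of_real r)), \<iota> (Im (of_real r))) = to_complexification R (\<iota> r)"
    by (simp add: to_complexification_def zero)
qed

lemma complexification_universal:
  assumes \<iota>: "\<iota> \<in> ring_hom real_ring R" and S: "cring S"
    and f: "f \<in> ring_hom R S" and g: "g \<in> ring_hom complex_ring S"
    and fg: "\<And>r. g (of_real r) = f (\<iota> r)"
  shows "\<exists>h \<in> ring_hom (complexification R) S.
      (\<forall>a\<in>carrier R. h (to_complexification R a) = f a) \<and> (\<forall>z. h (\<iota> (Re z), \<iota> (Im z)) = g z) \<and>
      (\<forall>h'\<in>ring_hom (complexification R) S.
        (\<forall>a\<in>carrier R. h' (to_complexification R a) = f a) \<and> (\<forall>z. h' (\<iota> (Re z), \<iota> (Im z)) = g z) \<longrightarrow>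
        (\<forall>x\<in>carrier (complexification R). h' x = h x))"
proof -
  interpret S: cring S by (fact S)
  have rr: "ring real_ring" "ring complex_ring" by (rule ring_from_type_algebra)+
  have \<iota>c: "\<iota> x \<in> carrier R" for x
    using ring_hom_closed[OF \<iota>, of x] by (simp add: ring_of_type_algebra_def)
  have \<iota>0: "\<iota> 0 = \<zero>"
    using ring_hom_zero[OF \<iota> rr(1) ring_axioms] by (simp add: ring_of_type_algebra_def)
  have \<iota>1: "\<iota> 1 = \<one>"
    using ring_hom_one[OF \<iota>] by (simp add: ring_of_type_algebra_def)
  have gc: "g z \<in> carrier S" for z
    using ring_hom_closed[OF g, of z] by (simp add: ring_of_type_algebra_def)
  have gadd: "g (x + y) = g x \<oplus>\<^bsub>S\<^esub> g y" for x y
    using ring_hom_add[OF g, of x y] by (simp add: ring_of_type_algebra_def)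
  have gmult: "g (x * y) = g x \<otimes>\<^bsub>S\<^esub> g y" for x y
    using ring_hom_mult[OF g, of x y] by (simp add: ring_of_type_algebra_def)
  have g1: "g 1 = \<one>\<^bsub>S\<^esub>"
    using ring_hom_one[OF g] by (simp add: ring_of_type_algebra_def)
  have g0: "g 0 = \<zero>\<^bsub>S\<^esub>"
    using ring_hom_zero[OF g rr(2) S.ring_axioms] by (simp add: ring_of_type_algebra_def)
  define j where "j = g \<i>"
  have j: "j \<in> carrier S" by (simp add: j_def gc)
  have "j \<otimes>\<^bsub>S\<^esub> j \<oplus>\<^bsub>S\<^esub> \<one>\<^bsub>S\<^esub> = g (\<i> * \<i> + 1)" by (simp only: gadd gmult g1 j_def)
  then have jj: "j \<otimes>\<^bsub>S\<^esub> j \<oplus>\<^bsub>S\<^esub> \<one>\<^bsub>S\<^esub> = \<zero>\<^bsub>S\<^esub>" by (simp add: g0)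
  have jj': "j \<otimes>\<^bsub>S\<^esub> j = \<ominus>\<^bsub>S\<^esub> \<one>\<^bsub>S\<^esub>"
    using S.minus_equality[OF jj S.one_closed] j by simp
  note fc = ring_hom_closed[OF f] and fadd = ring_hom_add[OF f] and fmult = ring_hom_mult[OF f]
  have f0: "f \<zero> = \<zero>\<^bsub>S\<^esub>" using ring_hom_zero[OF f ring_axioms S.ring_axioms] .
  have f1: "f \<one> = \<one>\<^bsub>S\<^esub>" using ring_hom_one[OF f] .
  have fdiff: "f (x \<ominus> y) = f x \<ominus>\<^bsub>S\<^esub> f y" if "x \<in> carrier R" "y \<in> carrier R" for x y
  proof -
    have "f (x \<ominus> y) \<oplus>\<^bsub>S\<^esub> f y = f ((x \<ominus> y) \<oplus> y)" using that by (simp add: fadd)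
    also have "(x \<ominus> y) \<oplus> y = x" using that by algebra
    finally have *: "f (x \<ominus> y) \<oplus>\<^bsub>S\<^esub> f y = f x" .
    have "f (x \<ominus> y) = (f (x \<ominus> y) \<oplus>\<^bsub>S\<^esub> f y) \<ominus>\<^bsub>S\<^esub> f y"
      using fc[of "x \<ominus> y"] fc[of y] that S.minus_closed by (simp add: S.minus_eq S.a_assoc S.r_neg)
    then show ?thesis by (simp add: *)
  qed
  define h where "h = (\<lambda>(a, b). f a \<oplus>\<^bsub>S\<^esub> j \<otimes>\<^bsub>S\<^esub> f b)"
  have key: "(p \<otimes>\<^bsub>S\<^esub> r \<ominus>\<^bsub>S\<^esub> q \<otimes>\<^bsub>S\<^esub> s) \<oplus>\<^bsub>S\<^esub> j \<otimes>\<^bsub>S\<^esub> (p \<otimes>\<^bsub>S\<^esub> s \<oplus>\<^bsub>S\<^esub> q \<otimes>\<^bsub>S\<^esub> r) =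
      (p \<oplus>\<^bsub>S\<^esub> j \<otimes>\<^bsub>S\<^esub> q) \<otimes>\<^bsub>S\<^esub> (r \<oplus>\<^bsub>S\<^esub> j \<otimes>\<^bsub>S\<^esub> s)"
    if "p \<in> carrier S" "q \<in> carrier S" "r \<in> carrier S" "s \<in> carrier S" for p q r s
  proof -
    have "(p \<oplus>\<^bsub>S\<^esub> j \<otimes>\<^bsub>S\<^esub> q) \<otimes>\<^bsub>S\<^esub> (r \<oplus>\<^bsub>S\<^esub> j \<otimes>\<^bsub>S\<^esub> s) =
        p \<otimes>\<^bsub>S\<^esub> r \<oplus>\<^bsub>S\<^esub> (j \<otimes>\<^bsub>S\<^esub> j) \<otimes>\<^bsub>S\<^esub> (q \<otimes>\<^bsub>S\<^esub> s) \<oplus>\<^bsub>S\<^esub> j \<otimes>\<^bsub>S\<^esub> (p \<otimes>\<^bsub>S\<^esub> s \<oplus>\<^bsub>S\<^esub> q \<otimes>\<^bsub>S\<^esub> r)"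
      using that j by algebra
    also have "(j \<otimes>\<^bsub>S\<^esub> j) \<otimes>\<^bsub>S\<^esub> (q \<otimes>\<^bsub>S\<^esub> s) = \<ominus>\<^bsub>S\<^esub> (q \<otimes>\<^bsub>S\<^esub> s)"
      unfolding jj' using that by (simp add: S.l_minus)
    finally show ?thesis by (simp add: S.minus_eq)
  qed
  have "h \<in> ring_hom (complexification R) S"
  proof (rule ring_hom_memI)
    fix x y assume "x \<in> carrier (complexification R)" "y \<in> carrier (complexification R)"
    then obtain a b c d where xy: "x = (a, b)" "y = (c, d)" and
      C: "a \<in> carrier R" "b \<in> carrier R" "c \<in> carrier R" "d \<in> carrier R"
      by (auto simp: complexification_def)
    show "h x \<in> carrier S" using C j by (simp add: xy h_def fc)
    show "h (x \<otimes>\<^bsub>complexification R\<^esub> y) = h x \<otimes>\<^bsub>S\<^esub> h y"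
      using C j by (simp add: xy h_def complexification_def fc fadd fmult fdiff key)
    have "(f a \<oplus>\<^bsub>S\<^esub> f c) \<oplus>\<^bsub>S\<^esub> j \<otimes>\<^bsub>S\<^esub> (f b \<oplus>\<^bsub>S\<^esub> f d) =
        (f a \<oplus>\<^bsub>S\<^esub> j \<otimes>\<^bsub>S\<^esub> f b) \<oplus>\<^bsub>S\<^esub> (f c \<oplus>\<^bsub>S\<^esub> j \<otimes>\<^bsub>S\<^esub> f d)"
      using C[THEN fc] j by algebra
    then show "h (x \<oplus>\<^bsub>complexification R\<^esub> y) = h x \<oplus>\<^bsub>S\<^esub> h y"
      using C by (simp add: xy h_def complexification_def fadd)
  next
    show "h \<one>\<^bsub>complexification R\<^esub> = \<one>\<^bsub>S\<^esub>"
      using j by (simp add: h_def complexification_def f0 f1)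
  qed
  moreover have "\<forall>a\<in>carrier R. h (to_complexification R a) = f a"
    using j by (simp add: h_def to_complexification_def f0 fc)
  moreover have "\<forall>z. h (\<iota> (Re z), \<iota> (Im z)) = g z"
  proof
    fix z
    have "g z = g (of_real (Re z) + \<i> * of_real (Im z))" by (rule arg_cong[OF complex_eq])
    then show "h (\<iota> (Re z), \<iota> (Im z)) = g z"
      by (simp add: h_def gadd gmult fg j_def)
  qed
  moreover have "h' x = h x"
    if h': "h' \<in> ring_hom (complexification R) S"
      and ext: "\<forall>a\<in>carrier R. h' (to_complexification R a) = f a" "\<forall>z. h' (\<iota> (Re z), \<iota> (Im z)) = g z"
      and x: "x \<in> carrier (complexification R)" for h' x
  proof -
    obtain a b where ab: "x = (a, b)" "a \<in> carrier R" "b \<in> carrier R"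
      using x by (auto simp: complexification_def)
    have hi: "h' (\<zero>, \<one>) = j" using ext(2)[rule_format, of \<i>] by (simp add: j_def \<iota>0 \<iota>1)
    have x_eq: "x = (a, \<zero>) \<oplus>\<^bsub>complexification R\<^esub> ((\<zero>, \<one>) \<otimes>\<^bsub>complexification R\<^esub> (b, \<zero>))"
      using ab by (simp add: complexification_def minus_eq)
    have car: "(a, \<zero>) \<in> carrier (complexification R)" "(\<zero>, \<one>) \<in> carrier (complexification R)"
      "(b, \<zero>) \<in> carrier (complexification R)"
      using ab by (simp_all add: complexification_def)
    interpret B: cring "complexification R" by (rule complexification_is_cring)
    have "h' x = h' (a, \<zero>) \<oplus>\<^bsub>S\<^esub> (h' (\<zero>, \<one>) \<otimes>\<^bsub>S\<^esub> h' (b, \<zero>))"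
      unfolding x_eq using car ring_hom_add[OF h'] ring_hom_mult[OF h'] by simp
    then show ?thesis
      using ext(1) ab by (simp add: hi h_def to_complexification_def)
  qed
  ultimately show ?thesis by blast
qed

end

text \<open>Both \<open>B\<^sup>*\<close> and \<open>K\<^sup>*\<close> are read as subgroups of \<open>L\<^sup>*\<close>, along the canonical embeddings
  \<open>B \<rightarrow> L\<close> and \<open>K \<rightarrow> L\<close>.\<close>

definition polar_subgroup :: "('a, 'm) ring_scheme \<Rightarrow> (('a \<times> 'a) \<times> ('a \<times> 'a)) set set" where
  "polar_subgroup A =
    (let B = complexification A; K = Frac A; L = Frac B
     in to_Frac B ` Units B <#>\<^bsub>units_of L\<^esub> Frac_map B (to_complexification A) ` Units K)"

definition polar_group :: "('a, 'm) ring_scheme \<Rightarrow> (('a \<times> 'a) \<times> ('a \<times> 'a)) set set monoid" where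
  "polar_group A = units_of (Frac (complexification A)) Mod polar_subgroup A"

lemma units_of_hom:
  assumes R: "ring R" and S: "ring S" and f: "f \<in> ring_hom R S"
  shows "group_hom (units_of R) (units_of S) f"
proof -
  interpret R: ring R by (fact R)
  interpret S: ring S by (fact S)
  have "f x \<in> Units S" if "x \<in> Units R" for x
  proof -
    have "f x \<otimes>\<^bsub>S\<^esub> f (inv\<^bsub>R\<^esub> x) = \<one>\<^bsub>S\<^esub>" "f (inv\<^bsub>R\<^esub> x) \<otimes>\<^bsub>S\<^esub> f x = \<one>\<^bsub>S\<^esub>"
      using that ring_hom_one[OF f] R.Units_r_inv[OF that] R.Units_l_inv[OF that]
        ring_hom_mult[OF f] by (metis R.Units_closed R.Units_inv_closed)+
    then show ?thesis
      using that ring_hom_closed[OF f] R.Units_closed R.Units_inv_closed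
      unfolding Units_def by blast
  qed
  then have "f \<in> hom (units_of R) (units_of S)"
    by (auto simp: hom_def units_of_def ring_hom_mult[OF f] R.Units_closed)
  then show ?thesis
    using R.units_group S.units_group by (simp add: group_hom_def group_hom_axioms_def)
qed

lemma polar_group_is_comm_group:
  assumes A: "domain A" and B: "domain (complexification A)"
  shows "subgroup (polar_subgroup A) (units_of (Frac (complexification A)))"
    and "comm_group (polar_group A)"
proof -
  let ?B = "complexification A" and ?K = "Frac A"
  let ?L = "Frac ?B"
  interpret A: domain A by (fact A)
  interpret B: domain ?B by (fact B)
  interpret K: field ?K by (rule A.Frac_is_field)
  interpret L: field ?L by (rule B.Frac_is_field)
  interpret LU: comm_group "units_of ?L" by (rule L.units_comm_group)
  interpret h1: group_hom "units_of ?B" "units_of ?L" "to_Frac ?B"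
    by (rule units_of_hom) (use B.ring_axioms L.ring_axioms B.to_Frac_hom in auto)
  interpret h2: group_hom "units_of ?K" "units_of ?L" "Frac_map ?B (to_complexification A)"
    by (rule units_of_hom)
      (use K.ring_axioms L.ring_axioms
        A.Frac_map_hom[OF B A.to_complexification_hom A.to_complexification_inj] in auto)
  show sub: "subgroup (polar_subgroup A) (units_of ?L)"
    unfolding polar_subgroup_def Let_def
    using LU.mult_subgroups[OF h1.img_is_subgroup h2.img_is_subgroup]
    by (simp add: units_of_carrier)
  show "comm_group (polar_group A)"
    unfolding polar_group_def by (rule LU.abelian_FactGroup[OF sub])
qed

definition torsion_free :: "('a, 'm) monoid_scheme \<Rightarrow> bool" where
  "torsion_free G \<longleftrightarrow>
    (\<forall>x\<in>carrier G. \<forall>n::nat. n > 0 \<longrightarrow> x [^]\<^bsub>G\<^esub> n = \<one>\<^bsub>G\<^esub> \<longrightarrow> x = \<one>\<^bsub>G\<^esub>)"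

definition algebraically_closed_in :: "'a set \<Rightarrow> ('a, 'm) ring_scheme \<Rightarrow> bool" where
  "algebraically_closed_in k R \<longleftrightarrow>
    (\<forall>x\<in>carrier R. (ring.algebraic R over k) x \<longrightarrow> x \<in> k)"

end

theory Submission
  imports Defs
begin

text \<open>
  Let \<open>f \<in> L\<^sup>*\<close> with \<open>f\<^sup>n \<in> B\<^sup>*K\<^sup>*\<close>. Multiplying numerator and denominator by the conjugate of the
  denominator, we may assume \<open>f \<in> B\<close>, and then \<open>f\<^sup>n = e b\<close> with \<open>e \<in> A\<close> nonzero and \<open>b \<in> B\<^sup>*\<close>.
  For a prime \<open>p\<close> of \<open>A\<close> the ring \<open>B/pB = (A/p)[i]\<close> is reduced because 2 is a unit in \<open>A\<close>; so if \<open>p\<close>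
  divides \<open>e\<close>, it divides \<open>f\<close>, and replacing \<open>f\<close> by \<open>f/p\<close> replaces \<open>e\<close> by \<open>e/p\<^sup>n\<close>. After finitely many
  steps \<open>e\<close> is a unit, and then so is \<open>f\<close>.
\<close>

section \<open>Divisibility by elements of the base ring in the complexification\<close>

context cring
begin

lemma divides_nat_pow_mono:
  assumes "p \<in> carrier R" "x \<in> carrier R" "p divides x [^] (m::nat)" "m \<le> n"
  shows "p divides x [^] n"
proof -
  have "x [^] n = x [^] m \<otimes> x [^] (n - m)"
    using assms by (simp add: nat_pow_mult)
  then show ?thesis
    using assms by (simp add: divides_prod_r)
qed

text \<open>The complexification is free over \<open>R\<close> with basis 1, i, and multiplication
  by \<open>(p, \<zero>)\<close> acts as \<open>p\<close> on each coordinate.\<close>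

lemma to_complexification_divides_iff:
  assumes "p \<in> carrier R" "x \<in> carrier (complexification R)"
  shows "to_complexification R p divides\<^bsub>complexification R\<^esub> x \<longleftrightarrow>
    p divides fst x \<and> p divides snd x"
  using assms
  by (auto simp: factor_def to_complexification_def complexification_def minus_eq)

text \<open>Multiplying the equation by the inverse of \<open>b\<close> shows that \<open>d\<close>
  divides \<open>c\<close> in the complexification; comparing first coordinates brings this down to
  \<open>R\<close>.\<close>

lemma to_complexification_cancel_unit:
  assumes d: "domain R" and b: "b \<in> Units (complexification R)"
    and c: "c \<in> carrier R" and e: "d \<in> carrier R" and x: "x \<in> carrier (complexification R)"
    and eq: "to_complexification R c \<otimes>\<^bsub>complexification R\<^esub> b =
      to_complexification R d \<otimes>\<^bsub>complexification R\<^esub> x"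
  shows "d divides c"
proof -
  let ?B = "complexification R" and ?s = "to_complexification R"
  interpret B: cring ?B by (rule complexification_is_cring)
  have s: "?s c \<in> carrier ?B" "?s d \<in> carrier ?B"
    using c e by (auto intro: ring_hom_closed[OF to_complexification_hom])
  have "?s c = ?s c \<otimes>\<^bsub>?B\<^esub> b \<otimes>\<^bsub>?B\<^esub> inv\<^bsub>?B\<^esub> b"
    using b s by (simp add: B.m_assoc B.Units_closed)
  also have "\<dots> = ?s d \<otimes>\<^bsub>?B\<^esub> (x \<otimes>\<^bsub>?B\<^esub> inv\<^bsub>?B\<^esub> b)"
    using b s x eq by (simp add: B.m_assoc B.Units_closed)
  finally have "?s d divides\<^bsub>?B\<^esub> ?s c"
    using x b by (auto simp: factor_def)
  then show ?thesis
    using to_complexification_divides_iff[OF e s(1)] by (simp add: to_complexification_def)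
qed

end

section \<open>Reducedness of the complexification modulo a prime\<close>

context domain
begin

text \<open>If \<open>p\<close> divides \<open>(u + iv)\<^sup>2 = (u\<^sup>2 - v\<^sup>2) + 2uvi\<close>, then it divides \<open>u\<close> or \<open>v\<close>, hence both
  \<open>u\<^sup>2\<close> and \<open>v\<^sup>2\<close>.\<close>

lemma prime_divides_complexification_square:
  assumes p: "p \<in> carrier R" "prime R p" and two: "\<one> \<oplus> \<one> \<in> Units R"
    and x: "x \<in> carrier (complexification R)"
    and dvd: "to_complexification R p divides\<^bsub>complexification R\<^esub> x \<otimes>\<^bsub>complexification R\<^esub> x"
  shows "to_complexification R p divides\<^bsub>complexification R\<^esub> x"
proof -
  interpret B: cring "complexification R" by (rule complexification_is_cring)
  obtain u v where uv: "x = (u, v)" "u \<in> carrier R" "v \<in> carrier R"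
    using x by (auto simp: complexification_def)
  have prime: "p divides a \<or> p divides b" if "p divides a \<otimes> b" "a \<in> carrier R" "b \<in> carrier R" for a b
    using p(2) that by (auto elim!: primeE)
  \<comment> \<open>A prime is not a unit, whereas every divisor of the unit 2 is one. This lets the
    factor 2 be dropped from 2uv below.\<close>
  have nd: "\<not> p divides (\<one> \<oplus> \<one>)"
    using p two divides_unit by (auto elim!: primeE)
  have sq: "p divides (u \<otimes> u \<ominus> v \<otimes> v)" and "p divides (u \<otimes> v \<oplus> v \<otimes> u)"
    using dvd to_complexification_divides_iff[OF p(1) B.m_closed[OF x x]]
    by (simp_all add: uv complexification_def)
  moreover have "u \<otimes> v \<oplus> v \<otimes> u = (\<one> \<oplus> \<one>) \<otimes> (u \<otimes> v)"
    using uv by algebra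
  ultimately have "p divides u \<or> p divides v"
    using prime[of "\<one> \<oplus> \<one>" "u \<otimes> v"] prime[of u v] nd uv by auto
  then have "p divides u \<and> p divides v"
  proof
    assume "p divides u"
    then obtain k where k: "k \<in> carrier R" "u = p \<otimes> k" by (auto simp: factor_def)
    obtain l where l: "l \<in> carrier R" "u \<otimes> u \<ominus> v \<otimes> v = p \<otimes> l" using sq by (auto simp: factor_def)
    have "v \<otimes> v = u \<otimes> u \<ominus> (u \<otimes> u \<ominus> v \<otimes> v)" using uv by algebra
    also have "\<dots> = p \<otimes> (k \<otimes> u \<ominus> l)" unfolding l(2) using k l(1) p uv(2) by algebra
    finally have "p divides v \<otimes> v" using k l uv by (auto simp: factor_def)
    then show ?thesis using prime uv \<open>p divides u\<close> by blast
  next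
    assume "p divides v"
    then obtain k where k: "k \<in> carrier R" "v = p \<otimes> k" by (auto simp: factor_def)
    obtain l where l: "l \<in> carrier R" "u \<otimes> u \<ominus> v \<otimes> v = p \<otimes> l" using sq by (auto simp: factor_def)
    have "u \<otimes> u = (u \<otimes> u \<ominus> v \<otimes> v) \<oplus> v \<otimes> v" using uv by algebra
    also have "\<dots> = p \<otimes> (k \<otimes> v \<oplus> l)" unfolding l(2) using k l(1) p uv(3) by algebra
    finally have "p divides u \<otimes> u" using k l uv by (auto simp: factor_def)
    then show ?thesis using prime uv \<open>p divides v\<close> by blast
  qed
  then show ?thesis
    using to_complexification_divides_iff[OF p(1) x] by (simp add: uv)
qed

text \<open>As \<open>n \<le> 2 ^ n\<close>, the divisibility passes to the exponent
  \<open>2 ^ n\<close>, and the square case then halves the exponent until it is 1.\<close>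

lemma prime_divides_complexification_pow:
  assumes p: "p \<in> carrier R" "prime R p" and two: "\<one> \<oplus> \<one> \<in> Units R"
    and x: "x \<in> carrier (complexification R)"
    and dvd: "to_complexification R p divides\<^bsub>complexification R\<^esub> x [^]\<^bsub>complexification R\<^esub> (n::nat)"
  shows "to_complexification R p divides\<^bsub>complexification R\<^esub> x"
proof -
  let ?B = "complexification R"
  interpret B: cring ?B by (rule complexification_is_cring)
  have "to_complexification R p divides\<^bsub>?B\<^esub> x"
    if "to_complexification R p divides\<^bsub>?B\<^esub> x [^]\<^bsub>?B\<^esub> ((2::nat) ^ m)" for m :: nat
    using that
  proof (induction m)
    case 0
    then show ?case using x by simp
  next
    case (Suc m)
    have "x [^]\<^bsub>?B\<^esub> ((2::nat) ^ Suc m) = x [^]\<^bsub>?B\<^esub> ((2::nat) ^ m) \<otimes>\<^bsub>?B\<^esub> x [^]\<^bsub>?B\<^esub> ((2::nat) ^ m)"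
      by (simp only: power_Suc mult_2 B.nat_pow_mult[OF x])
    then have "to_complexification R p divides\<^bsub>?B\<^esub> x [^]\<^bsub>?B\<^esub> ((2::nat) ^ m)"
      using prime_divides_complexification_square[OF p two B.nat_pow_closed[OF x]] Suc.prems by metis
    then show ?case by (rule Suc.IH)
  qed
  moreover have "n \<le> 2 ^ n" by (simp add: less_imp_le less_exp)
  ultimately show ?thesis
    using B.divides_nat_pow_mono[OF _ x dvd] ring_hom_closed[OF to_complexification_hom p(1)]
    by blast
qed

end

section \<open>Descent along prime divisors\<close>

text \<open>A nonzero non-unit has a nonempty factorization into irreducibles, and irreducibles of a
  factorial monoid are prime. Primality then transfers from \<open>mult_of R\<close> to
  \<open>R\<close>.\<close>

lemma (in domain) factorial_exists_prime_divisor: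
  assumes "factorial_monoid (mult_of R)" and "e \<in> carrier R" "e \<noteq> \<zero>" "e \<notin> Units R"
  obtains p where "p \<in> carrier R" "p \<noteq> \<zero>" "prime R p" "p divides e"
proof -
  interpret F: factorial_monoid "mult_of R" by fact
  obtain fs where fs: "set fs \<subseteq> carrier (mult_of R)" "wfactors (mult_of R) fs e"
    using F.wfactors_exist[of e] assms by auto
  have "fs \<noteq> []"
  proof
    assume "fs = []"
    then have "\<one> \<sim>\<^bsub>mult_of R\<^esub> e" using fs(2) by (simp add: wfactors_def)
    then have "e divides \<one>" by (simp add: associated_def)
    then show False using assms divides_one by blast
  qed
  then obtain p where p: "p \<in> set fs" by (cases fs) auto
  then have pc: "p \<in> carrier R" "p \<noteq> \<zero>" using fs(1) by auto
  have "prime (mult_of R) p"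
    using F.irreducible_prime fs p by (auto simp: wfactors_def)
  moreover have "p divides e"
    using mult_of.wfactors_dividesI[OF fs(2,1) _ p] assms by simp
  ultimately show ?thesis using that pc prime_eq_prime_mult by blast
qed

text \<open>The descent is a well-founded induction on \<open>e\<close> under proper divisibility.
  Each step divides \<open>x\<close> by a prime of \<open>R\<close>, so \<open>x\<close> varies,
  while the unit \<open>b\<close> stays fixed.\<close>

lemma (in domain) complexification_root_of_unit_multiple:
  assumes F: "factorial_monoid (mult_of R)" and B: "domain (complexification R)" and two: "\<one> \<oplus> \<one> \<in> Units R" and n: "(n::nat) > 0"
    and "e \<in> carrier R" "e \<noteq> \<zero>"
    and "x \<in> carrier (complexification R)" "b \<in> Units (complexification R)"
    and "x [^]\<^bsub>complexification R\<^esub> n =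
      to_complexification R e \<otimes>\<^bsub>complexification R\<^esub> b"
  obtains a u where "a \<in> carrier R" "a \<noteq> \<zero>" "u \<in> Units (complexification R)"
    "x = to_complexification R a \<otimes>\<^bsub>complexification R\<^esub> u"
proof -
  let ?B = "complexification R" and ?s = "to_complexification R"
  interpret B: domain ?B by (rule B)
  interpret s: ring_hom_ring R ?B ?s
    by (rule ring_hom_ringI2) (auto intro: ring_axioms B.ring_axioms to_complexification_hom)
  have s_nz: "?s a \<noteq> \<zero>\<^bsub>?B\<^esub>" if "a \<noteq> \<zero>" for a
    using that by (simp add: to_complexification_def complexification_def)
  interpret F: factorial_monoid "mult_of R" by (rule F)
  have "\<exists>a\<in>carrier R - {\<zero>}. \<exists>u\<in>Units ?B. x = ?s a \<otimes>\<^bsub>?B\<^esub> u"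
    using F.division_wellfounded assms(5-9)
  proof (induction e arbitrary: x rule: wf_induct_rule)
    case (less e)
    show ?case
    proof (cases "e \<in> Units R")
      \<comment> \<open>Now the power of \<open>x\<close> is a unit, and since \<open>n > 0\<close>
        its factor \<open>x\<close> is one too. The witnesses are \<open>a = \<one>\<close> and
        \<open>u = x\<close>.\<close>
      case True
      then have "?s e \<in> Units ?B"
        using group_hom.hom_closed[OF units_of_hom[OF ring_axioms B.ring_axioms to_complexification_hom]]
        by (simp add: units_of_carrier)
      then have "x [^]\<^bsub>?B\<^esub> n \<in> Units ?B" using less.prems by simp
      moreover obtain m where "n = Suc m" using n by (cases n) auto
      ultimately have "x \<in> Units ?B"
        using less.prems by (metis B.nat_pow_Suc2 B.nat_pow_closed B.unit_factor)
      then show ?thesis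
        using less.prems s.hom_one by (intro bexI[of _ \<one>] bexI[of _ x]) auto
    next
      case False
      then obtain p where p: "p \<in> carrier R" "p \<noteq> \<zero>" "prime R p" "p divides e"
        using factorial_exists_prime_divisor[OF F] less.prems by blast
      have pnu: "p \<notin> Units R" using p(3) by (auto elim: primeE)
      have sp: "?s p \<in> carrier ?B" and se: "?s e \<in> carrier ?B" and bc: "b \<in> carrier ?B"
        using p less.prems by (auto dest: B.Units_closed)
      have "?s p divides\<^bsub>?B\<^esub> ?s e"
        using p(4) less.prems(1) p(1) by (auto simp: factor_def)
      then have "?s p divides\<^bsub>?B\<^esub> x [^]\<^bsub>?B\<^esub> n"
        unfolding less.prems(5) using sp se bc by (simp add: B.divides_prod_r)
      then have "?s p divides\<^bsub>?B\<^esub> x"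
        using prime_divides_complexification_pow[OF p(1,3) two] less.prems by blast
      then obtain y where y: "y \<in> carrier ?B" "x = ?s p \<otimes>\<^bsub>?B\<^esub> y" by (auto simp: factor_def)
      have xn: "?s e \<otimes>\<^bsub>?B\<^esub> b = ?s (p [^] n) \<otimes>\<^bsub>?B\<^esub> y [^]\<^bsub>?B\<^esub> n"
        using less.prems(5) y sp p by (simp add: B.nat_pow_distrib s.hom_nat_pow)
      \<comment> \<open>Since \<open>b\<close> is a unit, the full power \<open>p [^] n\<close>, and
        not only \<open>p\<close>, can be split off from \<open>e\<close> inside
        \<open>R\<close>.\<close>
      have "p [^] n divides e"
        by (rule to_complexification_cancel_unit[OF domain_axioms less.prems(4,1) _ _ xn])
          (use p y in auto)
      then obtain c where c: "c \<in> carrier R" "e = p [^] n \<otimes> c" by (auto simp: factor_def)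
      have pn: "p [^] n \<in> carrier R" "p [^] n \<noteq> \<zero>"
        using p(1) less.prems(2) c by (simp_all add: integral_iff)
      have cnz: "c \<noteq> \<zero>" using less.prems(2) c(2) pn(1) by (metis r_null)
      have "?s (p [^] n) \<otimes>\<^bsub>?B\<^esub> (y [^]\<^bsub>?B\<^esub> n) = ?s (p [^] n) \<otimes>\<^bsub>?B\<^esub> (?s c \<otimes>\<^bsub>?B\<^esub> b)"
        using xn[symmetric] c(1) pn(1) bc unfolding c(2) by (simp add: B.m_assoc)
      then have yn: "y [^]\<^bsub>?B\<^esub> n = ?s c \<otimes>\<^bsub>?B\<^esub> b"
        using B.m_lcancel[OF s_nz[OF pn(2)]] pn(1) c(1) bc y(1) by simp
      \<comment> \<open>The induction needs \<open>c\<close> to be a proper factor of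
        \<open>e\<close>. Otherwise \<open>p [^] n\<close> would be a unit and, because
        \<open>n > 0\<close>, so would \<open>p\<close>.\<close>
      have "\<not> e divides c"
      proof
        assume "e divides c"
        then obtain d where d: "d \<in> carrier R" "c = e \<otimes> d" by (auto simp: factor_def)
        then have "c \<otimes> (p [^] n \<otimes> d) = c \<otimes> \<one>" using c pn by (metis m_assoc m_comm m_closed r_one)
        then have "p [^] n \<otimes> d = \<one>" using m_lcancel[OF cnz c(1)] d pn by simp
        moreover obtain m where "n = Suc m" using n by (cases n) auto
        ultimately have "p \<otimes> (p [^] m \<otimes> d) = \<one>" using p d by (metis nat_pow_Suc2 m_assoc nat_pow_closed)
        then have "p divides \<one>" unfolding factor_def using p(1) d(1) by (metis m_closed nat_pow_closed)
        then show False using pnu p divides_one by blast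
      qed
      moreover have "c divides e" using c pn m_comm by (auto simp: factor_def)
      ultimately have "properfactor (mult_of R) c e"
        using c(1) less.prems by (auto simp: properfactor_def)
      then obtain a u where au: "a \<in> carrier R" "a \<noteq> \<zero>" "u \<in> Units ?B" "y = ?s a \<otimes>\<^bsub>?B\<^esub> u"
        using less.IH[of c y] c(1) cnz y(1) yn less.prems by auto
      \<comment> \<open>The prime removed from \<open>x\<close> is put back into the factor from
        \<open>R\<close>; the unit \<open>u\<close> found for \<open>y\<close> is kept.\<close>
      then have "x = ?s (p \<otimes> a) \<otimes>\<^bsub>?B\<^esub> u" using y p sp by (simp add: B.m_assoc B.Units_closed)
      then show ?thesis using au p by (intro bexI[of _ "p \<otimes> a"] bexI[of _ u]) (auto simp: integral_iff)
    qed
  qed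
  then show ?thesis using that by auto
qed

section \<open>Roots of elements of the polar subgroup\<close>

lemma (in domain) fraction_nat_pow:
  assumes "a \<in> carrier R" "b \<in> carrier R" "b \<noteq> \<zero>"
  shows "fraction R a b [^]\<^bsub>Frac R\<^esub> (n::nat) = fraction R (a [^] n) (b [^] n)"
    and "b [^] n \<noteq> \<zero>"
proof -
  have nz: "b [^] n \<noteq> \<zero>" for n :: nat
    using assms by (induction n) (auto simp: integral_iff)
  then show "b [^] n \<noteq> \<zero>" .
  show "fraction R a b [^]\<^bsub>Frac R\<^esub> n = fraction R (a [^] n) (b [^] n)"
    using assms nz by (induction n) (simp_all add: Frac_one Frac_mult)
qed

text \<open>The units of the fraction field of \<open>R\<close> are the \<open>p / q\<close> with
  both entries nonzero, so an element of the polar subgroup is a fraction \<open>b p / q\<close>.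
  Cross-multiplication turns membership into an equation in the complexification.\<close>

lemma (in domain) mem_polar_subgroup_iff:
  assumes B: "domain (complexification R)"
    and x: "x \<in> carrier (complexification R)"
    and y: "y \<in> carrier (complexification R)" "y \<noteq> \<zero>\<^bsub>complexification R\<^esub>"
  shows "fraction (complexification R) x y \<in> polar_subgroup R \<longleftrightarrow>
    (\<exists>b\<in>Units (complexification R). \<exists>p\<in>carrier R - {\<zero>}. \<exists>q\<in>carrier R - {\<zero>}.
      x \<otimes>\<^bsub>complexification R\<^esub> to_complexification R q =
      (b \<otimes>\<^bsub>complexification R\<^esub> to_complexification R p) \<otimes>\<^bsub>complexification R\<^esub> y)"
proof -
  let ?B = "complexification R" and ?s = "to_complexification R"
  interpret B: domain ?B by (rule B)
  interpret K: field "Frac R" by (rule Frac_is_field)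
  note sc = ring_hom_closed[OF to_complexification_hom]
  have s_nz: "?s a \<noteq> \<zero>\<^bsub>?B\<^esub>" if "a \<noteq> \<zero>" for a
    using that by (simp add: to_complexification_def complexification_def)
  have UK: "Units (Frac R) = {fraction R p q |p q. p \<in> carrier R - {\<zero>} \<and> q \<in> carrier R - {\<zero>}}"
  proof (intro equalityI subsetI)
    fix U assume "U \<in> Units (Frac R)"
    then have U: "U \<in> carrier (Frac R)" "U \<noteq> \<zero>\<^bsub>Frac R\<^esub>" by (auto simp: K.field_Units)
    obtain p q where pq: "p \<in> carrier R" "q \<in> carrier R" "q \<noteq> \<zero>" "U = fraction R p q"
      using U(1) by (rule Frac_cases)
    then have "p \<noteq> \<zero>" using U(2) by (auto simp: Frac_zero fraction_eq_iff)
    then show "U \<in> {fraction R p q |p q. p \<in> carrier R - {\<zero>} \<and> q \<in> carrier R - {\<zero>}}"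
      using pq by blast
  qed (auto simp: K.field_Units Frac_zero fraction_eq_iff)
  have *: "to_Frac ?B b \<otimes>\<^bsub>Frac ?B\<^esub> Frac_map ?B ?s (fraction R p q) =
      fraction ?B (b \<otimes>\<^bsub>?B\<^esub> ?s p) (?s q)"
    if "b \<in> Units ?B" "p \<in> carrier R" "q \<in> carrier R" "q \<noteq> \<zero>" for b p q
    using that Frac_map_fraction[OF B to_complexification_hom to_complexification_inj that(2-)]
    by (simp add: to_Frac_def B.Frac_mult sc B.Units_closed)
  have "fraction ?B x y \<in> polar_subgroup R \<longleftrightarrow>
    (\<exists>b\<in>Units ?B. \<exists>p\<in>carrier R - {\<zero>}. \<exists>q\<in>carrier R - {\<zero>}.
      fraction ?B x y = to_Frac ?B b \<otimes>\<^bsub>Frac ?B\<^esub> Frac_map ?B ?s (fraction R p q))"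
    unfolding polar_subgroup_def Let_def set_mult_def units_of_mult UK by blast
  also have "\<dots> \<longleftrightarrow> (\<exists>b\<in>Units ?B. \<exists>p\<in>carrier R - {\<zero>}. \<exists>q\<in>carrier R - {\<zero>}.
      x \<otimes>\<^bsub>?B\<^esub> ?s q = (b \<otimes>\<^bsub>?B\<^esub> ?s p) \<otimes>\<^bsub>?B\<^esub> y)"
    by (intro bex_cong refl) (use x y in \<open>auto simp: * B.fraction_eq_iff sc s_nz B.Units_closed\<close>)
  finally show ?thesis .
qed

lemma (in domain) polar_subgroup_root_closed:
  assumes F: "factorial_monoid (mult_of R)" and B: "domain (complexification R)" and two: "\<one> \<oplus> \<one> \<in> Units R" and n: "(n::nat) > 0"
    and f: "f \<in> carrier (Frac (complexification R))"
    and fn: "f [^]\<^bsub>Frac (complexification R)\<^esub> n \<in> polar_subgroup R"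
  shows "f \<in> polar_subgroup R"
proof -
  let ?B = "complexification R" and ?s = "to_complexification R"
  interpret B: domain ?B by (rule B)
  interpret s: ring_hom_ring R ?B ?s
    by (rule ring_hom_ringI2) (auto intro: ring_axioms B.ring_axioms to_complexification_hom)
  have s_nz: "?s a \<noteq> \<zero>\<^bsub>?B\<^esub>" if "a \<noteq> \<zero>" for a
    using that by (simp add: to_complexification_def complexification_def)
  obtain x y where xy: "x \<in> carrier ?B" "y \<in> carrier ?B" "y \<noteq> \<zero>\<^bsub>?B\<^esub>" "f = fraction ?B x y"
    using f by (elim B.Frac_cases)
  \<comment> \<open>the conjugate and the norm of \<open>y\<close>\<close>
  define z where "z = (fst y, \<ominus> snd y)"
  define N where "N = fst y \<otimes> fst y \<oplus> snd y \<otimes> snd y"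
  have z: "z \<in> carrier ?B" and N: "N \<in> carrier R"
    using xy(2) by (auto simp: z_def N_def complexification_def)
  have yz: "y \<otimes>\<^bsub>?B\<^esub> z = ?s N"
  proof -
    have "u \<otimes> u \<ominus> v \<otimes> (\<ominus> v) = u \<otimes> u \<oplus> v \<otimes> v" "u \<otimes> (\<ominus> v) \<oplus> v \<otimes> u = \<zero>"
      if "u \<in> carrier R" "v \<in> carrier R" for u v
      using that by algebra+
    then show ?thesis
      using xy(2) by (auto simp: z_def N_def complexification_def to_complexification_def)
  qed
  \<comment> \<open>The conjugate of a nonzero element is nonzero; as the complexification is a
    domain, the product \<open>N\<close> of \<open>y\<close> and \<open>z\<close> is then nonzero as
    well.\<close>
  have "z \<noteq> \<zero>\<^bsub>?B\<^esub>"
    using xy by (auto simp: z_def complexification_def)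
  then have Nnz: "N \<noteq> \<zero>"
    using yz xy z B.integral_iff by (auto simp: to_complexification_def complexification_def)
  obtain b p q where b: "b \<in> Units ?B" and p: "p \<in> carrier R" "p \<noteq> \<zero>" and q: "q \<in> carrier R" "q \<noteq> \<zero>"
    and eq: "x [^]\<^bsub>?B\<^esub> n \<otimes>\<^bsub>?B\<^esub> ?s q = (b \<otimes>\<^bsub>?B\<^esub> ?s p) \<otimes>\<^bsub>?B\<^esub> y [^]\<^bsub>?B\<^esub> n"
    using fn unfolding xy(4) B.fraction_nat_pow(1)[OF xy(1-3)]
    by (subst (asm) mem_polar_subgroup_iff[OF B])
      (use xy in \<open>auto simp: B.fraction_nat_pow(2)\<close>)
  have bc: "b \<in> carrier ?B" using b by (rule B.Units_closed)
  \<comment> \<open>\<open>f = x / y = g / N\<close>, so \<open>g\<close> lies in the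
    complexification and differs from \<open>f\<close> only by a nonzero element of
    \<open>R\<close>.\<close>
  define g where "g = x \<otimes>\<^bsub>?B\<^esub> z"
  have g: "g \<in> carrier ?B" using xy z by (simp add: g_def)
  have Nn: "N [^] n \<in> carrier R" "N [^] n \<noteq> \<zero>" using N Nnz fraction_nat_pow(2) by auto
  have "?s q \<otimes>\<^bsub>?B\<^esub> g [^]\<^bsub>?B\<^esub> n = (x [^]\<^bsub>?B\<^esub> n \<otimes>\<^bsub>?B\<^esub> ?s q) \<otimes>\<^bsub>?B\<^esub> z [^]\<^bsub>?B\<^esub> n"
    using xy z q by (simp add: g_def B.nat_pow_distrib B.m_ac)
  also have "\<dots> = ?s p \<otimes>\<^bsub>?B\<^esub> (y \<otimes>\<^bsub>?B\<^esub> z) [^]\<^bsub>?B\<^esub> n \<otimes>\<^bsub>?B\<^esub> b"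
    unfolding eq using xy z p bc by (simp add: B.nat_pow_distrib B.m_ac)
  also have "\<dots> = ?s (p \<otimes> N [^] n) \<otimes>\<^bsub>?B\<^esub> b"
    unfolding yz using p N by (simp add: s.hom_nat_pow)
  finally have gn: "?s (p \<otimes> N [^] n) \<otimes>\<^bsub>?B\<^esub> b = ?s q \<otimes>\<^bsub>?B\<^esub> g [^]\<^bsub>?B\<^esub> n" ..
  \<comment> \<open>This removes the denominator \<open>q\<close>: the quotient \<open>e\<close>
    lies in \<open>R\<close>, and the n-th power of \<open>g\<close> is \<open>e\<close> times the
    unit \<open>b\<close>, as the descent requires.\<close>
  have "q divides p \<otimes> N [^] n"
    by (rule to_complexification_cancel_unit[OF domain_axioms b _ _ _ gn]) (use p q Nn g in auto)
  then obtain e where e: "e \<in> carrier R" "p \<otimes> N [^] n = q \<otimes> e" by (auto simp: factor_def)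
  have "e \<noteq> \<zero>" using e p q Nn by (metis integral_iff r_null)
  have "?s q \<otimes>\<^bsub>?B\<^esub> g [^]\<^bsub>?B\<^esub> n = ?s q \<otimes>\<^bsub>?B\<^esub> (?s e \<otimes>\<^bsub>?B\<^esub> b)"
    using gn e q bc by (simp add: B.m_assoc)
  then have "g [^]\<^bsub>?B\<^esub> n = ?s e \<otimes>\<^bsub>?B\<^esub> b"
    using B.m_lcancel[OF s_nz] q e bc g by simp
  then obtain a u where a: "a \<in> carrier R" "a \<noteq> \<zero>" and u: "u \<in> Units ?B" and gau: "g = ?s a \<otimes>\<^bsub>?B\<^esub> u"
    using complexification_root_of_unit_multiple[OF F B two n e(1) \<open>e \<noteq> \<zero>\<close> g b] by blast
  \<comment> \<open>Here \<open>f = g / N = u (a / N)\<close>, so \<open>u\<close>, \<open>a\<close>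
    and \<open>N\<close> serve as \<open>b\<close>, \<open>p\<close> and \<open>q\<close> in the
    membership criterion.\<close>
  have "x \<otimes>\<^bsub>?B\<^esub> ?s N = g \<otimes>\<^bsub>?B\<^esub> y"
    unfolding yz[symmetric] g_def using xy z by (simp add: B.m_ac)
  also have "\<dots> = (u \<otimes>\<^bsub>?B\<^esub> ?s a) \<otimes>\<^bsub>?B\<^esub> y"
    unfolding gau using a u by (simp add: B.m_comm B.Units_closed)
  finally show ?thesis
    unfolding xy(4) mem_polar_subgroup_iff[OF B xy(1-3)] using a u N Nnz by blast
qed

section \<open>Torsion of the quotient group\<close>

text \<open>The n-th power of the coset of \<open>x\<close> is the coset of \<open>x [^] n\<close>,
  which is trivial only if \<open>x [^] n\<close> lies in \<open>H\<close>; closure of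
  \<open>H\<close> under roots then makes the coset of \<open>x\<close> trivial.\<close>

lemma (in group) torsion_free_Mod:
  assumes "normal H G"
    and root: "\<And>x n. x \<in> carrier G \<Longrightarrow> (n::nat) > 0 \<Longrightarrow> x [^] n \<in> H \<Longrightarrow> x \<in> H"
  shows "torsion_free (G Mod H)"
  unfolding torsion_free_def
proof (intro ballI allI impI)
  interpret normal H G by (rule assms)
  fix U and n :: nat
  assume "U \<in> carrier (G Mod H)" and n: "n > 0" "U [^]\<^bsub>G Mod H\<^esub> n = \<one>\<^bsub>G Mod H\<^esub>"
  then obtain x where x: "x \<in> carrier G" "U = H #> x"
    by (auto simp: FactGroup_def RCOSETS_def)
  then have "H #> x [^] n = H" using n FactGroup_pow[of x n] by simp
  then have "x [^] n \<in> H" using x is_subgroup by (metis coset_join1 nat_pow_closed subgroup.subset)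
  then show "U = \<one>\<^bsub>G Mod H\<^esub>"
    using root[OF x(1) n(1)] x coset_join2 is_subgroup by simp
qed

theorem theorem5p5:
  fixes A :: "('a, 'm) ring_scheme" and \<iota> :: "real \<Rightarrow> 'a"
  assumes "noetherian_domain A"
    and "\<iota> \<in> ring_hom real_ring A"
    and "algebraically_closed_in (range \<iota>) A"
    and "domain (complexification A)"
    and "factorial_domain A"
  shows "torsion_free (polar_group A)"
proof -
  let ?L = "Frac (complexification A)"
  have F: "domain A" "factorial_monoid (mult_of A)"
    using assms(5) by (auto simp: factorial_domain_def)
  interpret A: domain A by (rule F)
  interpret B: domain "complexification A" by fact
  interpret L: field ?L by (rule B.Frac_is_field)
  interpret LU: comm_group "units_of ?L" by (rule L.units_comm_group)
  \<comment> \<open>The image of the real number 1/2 under \<open>\<iota>\<close> is an inverse of 2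
    in \<open>A\<close>.\<close>
  have "\<one>\<^bsub>A\<^esub> = \<iota> (2 * (1/2))"
    using ring_hom_one[OF assms(2)] by (simp add: ring_of_type_algebra_def)
  also have "\<dots> = \<iota> (1 + 1) \<otimes>\<^bsub>A\<^esub> \<iota> (1/2)"
    using ring_hom_mult[OF assms(2), of 2 "1/2"] by (simp add: ring_of_type_algebra_def)
  also have "\<iota> (1 + 1) = \<one>\<^bsub>A\<^esub> \<oplus>\<^bsub>A\<^esub> \<one>\<^bsub>A\<^esub>"
    using ring_hom_add[OF assms(2), of 1 1] ring_hom_one[OF assms(2)]
    by (simp add: ring_of_type_algebra_def)
  finally have "(\<one>\<^bsub>A\<^esub> \<oplus>\<^bsub>A\<^esub> \<one>\<^bsub>A\<^esub>) divides\<^bsub>A\<^esub> \<one>\<^bsub>A\<^esub>"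
    using ring_hom_closed[OF assms(2), of "1/2"] by (auto simp: factor_def ring_of_type_algebra_def)
  then have two: "\<one>\<^bsub>A\<^esub> \<oplus>\<^bsub>A\<^esub> \<one>\<^bsub>A\<^esub> \<in> Units A"
    by (simp add: A.divides_one)
  have pow: "f [^]\<^bsub>units_of ?L\<^esub> n = f [^]\<^bsub>?L\<^esub> n" for f and n :: nat
    by (simp add: nat_pow_def units_of_def)
  have sub: "subgroup (polar_subgroup A) (units_of ?L)"
    by (rule polar_group_is_comm_group(1)) (rule F assms)+
  show ?thesis
    unfolding polar_group_def
  proof (rule LU.torsion_free_Mod)
    show "normal (polar_subgroup A) (units_of ?L)"
      using sub by (simp add: LU.subgroup_imp_normal)
    show "f \<in> polar_subgroup A"
      if "f \<in> carrier (units_of ?L)" "n > 0" "f [^]\<^bsub>units_of ?L\<^esub> n \<in> polar_subgroup A" for f and n :: nat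
      using that A.polar_subgroup_root_closed[OF F(2) assms(4) two, of n f]
      by (simp add: pow units_of_carrier L.Units_closed)
  qed
qed

end
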